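(* Let $q$ be a prime power and $n\ge 3$ an integer. Let $L_U$ be a maximum $2$-scattered $\mathbb{F}_q$-linear set in the plane $\mathrm{PG}(2,q^n)$ (so of rank $n$), let $N=|L_U|=\frac{q^n-1}{q-1}$, and let $\mathcal{C}_{L_U}$ be the associated $\mathbb{F}_{q^n}$-linear code of length $N$ and dimension $3$. Then the minimum distance of $\mathcal{C}_{L_U}$ is $N-q-1$, so that its defect in the Singleton bound is $q-1$. In particular, for $q=2$ the code $\mathcal{C}_{L_U}$ is an almost MDS code.
   Context: Linear sets: Let $V$ be a $3$-dimensional $\mathbb{F}_{q^n}$-vector space. An $\mathbb{F}_q$-linear set of rank $k$ in $\mathrm{PG}(V,\mathbb{F}_{q^n})=\mathrm{PG}(2,q^n)$ is a point set $L_U=\{\langle u\rangle_{\mathbb{F}_{q^n}} : u\in U\setminus\{0\}\}$, where $U$ is a $k$-dimensional $\mathbb{F}_q$-subspace of $V$. It is $2$-scattered if it spans $\mathrm{PG}(2,q^n)$ and $\dim_{\mathbb{F}_q}(W\cap U)\le 2$ for every line $\mathrm{PG}(W,\mathbb{F}_{q^n})$; it is maximum $2$-scattered if moreover its rank is $n$. Code: Write $L_U=\{\langle (g_{1i},g_{2i},g_{3i})\rangle_{\mathbb{F}_{q^n}} : i\in\{1,\ldots,N\}\}$ with $N=|L_U|$ (one representative vector per point). $\mathcal{C}_{L_U}$ is the $\mathbb{F}_{q^n}$-linear code whose generator matrix is the $(3\times N)$-matrix having these vectors as columns. For a linear code of length $m$, dimension $k$ and minimum (Hamming) distance $d$, the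 Singleton bound is $d\le m-k+1$ and the defect is $m-k+1-d$. The code is almost MDS if $d=m-k$. *)

theory Defs
  imports "HOL-Analysis.Analysis" "HOL-Number_Theory.Prime_Powers"
begin

(* F_q is a type 'f, F_{q^n} is a type 'k, and \<phi> is the inclusion of F_q in F_{q^n}. *)

definition field_embedding :: "('f::field \<Rightarrow> 'k::field) \<Rightarrow> bool" where
  "field_embedding \<phi> \<longleftrightarrow>
     \<phi> 1 = 1 \<and> (\<forall>a b. \<phi> (a + b) = \<phi> a + \<phi> b) \<and> (\<forall>a b. \<phi> (a * b) = \<phi> a * \<phi> b)"

definition restrict_scalars :: "('f \<Rightarrow> 'k) \<Rightarrow> ('k \<Rightarrow> 'v \<Rightarrow> 'v) \<Rightarrow> 'f \<Rightarrow> 'v \<Rightarrow> 'v" where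
  "restrict_scalars \<phi> smul = (\<lambda>a. smul (\<phi> a))"

(* Points of PG(V) are the one-dimensional 'k-subspaces of V, represented as sets of vectors. *)

definition linear_set :: "('k::field \<Rightarrow> 'v::ab_group_add \<Rightarrow> 'v) \<Rightarrow> 'v set \<Rightarrow> 'v set set" where
  "linear_set smul U = (\<lambda>u. module.span smul {u}) ` (U - {0})"

definition projective_line :: "('k::field \<Rightarrow> 'v::ab_group_add \<Rightarrow> 'v) \<Rightarrow> 'v set \<Rightarrow> bool" where
  "projective_line smul W \<longleftrightarrow> module.subspace smul W \<and> vector_space.dim smul W = 2"

definition two_scattered ::
  "('f::field \<Rightarrow> 'k::field) \<Rightarrow> ('k \<Rightarrow> 'v::ab_group_add \<Rightarrow> 'v) \<Rightarrow> 'v set \<Rightarrow> bool" where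
  "two_scattered \<phi> smul U \<longleftrightarrow>
     module.subspace (restrict_scalars \<phi> smul) U \<and>
     module.span smul (\<Union> (linear_set smul U)) = UNIV \<and>
     (\<forall>W. projective_line smul W \<longrightarrow>
        vector_space.dim (restrict_scalars \<phi> smul) (W \<inter> U) \<le> 2)"

(* n is the degree of 'k over 'f. *)
definition maximum_two_scattered ::
  "nat \<Rightarrow> ('f::field \<Rightarrow> 'k::field) \<Rightarrow> ('k \<Rightarrow> 'v::ab_group_add \<Rightarrow> 'v) \<Rightarrow> 'v set \<Rightarrow> bool" where
  "maximum_two_scattered n \<phi> smul U \<longleftrightarrow>
     two_scattered \<phi> smul U \<and> vector_space.dim (restrict_scalars \<phi> smul) U = n"

(* The columns of a generator matrix are labelled by a finite type 'm, whose cardinality is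
   the length of the code. *)

definition generator_matrix :: "('v \<Rightarrow> 'k ^ 3) \<Rightarrow> ('m::finite \<Rightarrow> 'v) \<Rightarrow> 'k ^ 'm ^ 3" where
  "generator_matrix coord g = (\<chi> i j. coord (g j) $ i)"

definition code_of_matrix :: "'k::field ^ 'm::finite ^ 'r::finite \<Rightarrow> ('k ^ 'm) set" where
  "code_of_matrix G = vec.span (rows G)"

definition hamming_dist :: "'k ^ 'm::finite \<Rightarrow> 'k ^ 'm \<Rightarrow> nat" where
  "hamming_dist x y = card {j. x $ j \<noteq> y $ j}"

definition min_distance :: "('k ^ 'm::finite) set \<Rightarrow> nat" where
  "min_distance C = Min {hamming_dist x y | x y. x \<in> C \<and> y \<in> C \<and> x \<noteq> y}"

definition singleton_defect :: "('k::field ^ 'm::finite) set \<Rightarrow> int" where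
  "singleton_defect C = int CARD('m) - int (vec.dim C) + 1 - int (min_distance C)"

definition almost_MDS :: "('k::field ^ 'm::finite) set \<Rightarrow> bool" where
  "almost_MDS C \<longleftrightarrow>
     vec.subspace C \<and> int (min_distance C) = int CARD('m) - int (vec.dim C)"

end

theory Submission
  imports Defs
begin

text \<open>
  Write \<open>q\<close> for the order of the small field. The codewords are the vectors of values
  \<open>(f (g j))\<^sub>j\<close>, where \<open>f\<close> runs through the linear functionals of \<open>V\<close>. If \<open>f \<noteq> 0\<close>, the zero
  coordinates of such a word are the points of \<open>L\<^sub>U\<close> on the line \<open>ker f\<close>, so the minimum distance
  is \<open>N\<close> minus the largest number of points of \<open>L\<^sub>U\<close> on a line.

  Points of \<open>L\<^sub>U\<close> on a line are counted by counting vectors of \<open>U\<close>. This is possible because every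
  point of \<open>L\<^sub>U\<close> meets \<open>U\<close> in an \<open>\<bbbF>\<^sub>q\<close>-subspace of dimension exactly one
  (\<open>point_Int_U\<close>): a point with two independent vectors of \<open>U\<close>, joined to a third vector of \<open>U\<close>
  outside it, would give a line meeting \<open>U\<close> in dimension three. Hence each point accounts for
  \<open>q - 1\<close> nonzero vectors (\<open>card_points_in_subspace\<close>). For the whole space this gives
  \<open>N = (q^n - 1) / (q - 1)\<close>; for a line, which contains at most \<open>q^2\<close> vectors of \<open>U\<close>, it
  gives at most \<open>q + 1\<close> points. The bound is attained on the line joining any two points of
  \<open>L\<^sub>U\<close>. Finally \<open>q + 1 < N\<close> because \<open>n \<ge> 3\<close>, so a nonzero functional
  gives a nonzero word and the code has dimension three.
\<close>

section \<open>Cardinalities of subspaces over a finite field\<close>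

lemma card_span_independent:
  fixes scale :: "'a::{field,finite} \<Rightarrow> 'b::ab_group_add \<Rightarrow> 'b"
  assumes "vector_space scale" and "finite B" and "\<not> module.dependent scale B"
  shows "card (module.span scale B) = CARD('a) ^ card B"
proof -
  interpret vector_space scale by fact
  show ?thesis
    using assms(2,3)
  proof (induction B rule: finite_induct)
    case empty
    then show ?case by simp
  next
    case (insert b B)
    have ind: "independent B" and b: "b \<notin> span B"
      using insert by (auto simp: independent_insert)
    have "bij_betw (\<lambda>(c, x). scale c b + x) (UNIV \<times> span B) (span (insert b B))"
      unfolding bij_betw_def
    proof
      show "inj_on (\<lambda>(c, x). scale c b + x) (UNIV \<times> span B)"
      proof (rule inj_onI, clarify)
        fix c d x y
        assume x: "x \<in> span B" and y: "y \<in> span B" and eq: "scale c b + x = scale d b + y"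
        have "scale (c - d) b = y - x"
          using eq by (simp add: scale_left_diff_distrib algebra_simps)
        hence in_span: "scale (c - d) b \<in> span B"
          using x y by (simp add: span_diff)
        have "c = d"
        proof (rule ccontr)
          assume "c \<noteq> d"
          hence "b = scale (inverse (c - d)) (scale (c - d) b)" by simp
          thus False using b span_scale[OF in_span] by metis
        qed
        thus "c = d \<and> x = y" using eq by simp
      qed
      show "(\<lambda>(c, x). scale c b + x) ` (UNIV \<times> span B) = span (insert b B)"
      proof (intro equalityI subsetI)
        fix v assume "v \<in> (\<lambda>(c, x). scale c b + x) ` (UNIV \<times> span B)"
        then obtain c x where "x \<in> span B" "v = scale c b + x" by auto
        thus "v \<in> span (insert b B)" by (auto simp: span_insert intro!: exI[of _ c])
      next
        fix v assume "v \<in> span (insert b B)"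
        then obtain c where "v - scale c b \<in> span B" by (auto simp: span_insert)
        moreover have "v = scale c b + (v - scale c b)" by simp
        ultimately show "v \<in> (\<lambda>(c, x). scale c b + x) ` (UNIV \<times> span B)" by force
      qed
    qed
    hence "card (span (insert b B)) = card ((UNIV :: 'a set) \<times> span B)"
      by (simp add: bij_betw_same_card)
    also have "\<dots> = CARD('a) * CARD('a) ^ card B"
      using insert.IH[OF ind] by (simp add: card_cartesian_product)
    finally show ?case using insert.hyps by simp
  qed
qed

lemma card_subspace:
  fixes scale :: "'a::{field,finite} \<Rightarrow> 'b::ab_group_add \<Rightarrow> 'b"
  assumes "vector_space scale" and "module.subspace scale S" and "finite S"
  shows "card S = CARD('a) ^ vector_space.dim scale S"
proof -
  interpret vector_space scale by fact
  obtain B where B: "B \<subseteq> S" "independent B" "S \<subseteq> span B" "card B = dim S"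
    using basis_exists by blast
  have "span B = S" using B assms(2) by (simp add: span_subspace)
  thus ?thesis
    using card_span_independent[OF assms(1) _ B(2)] B(1,4) finite_subset[OF B(1) assms(3)] by simp
qed

section \<open>Counting points of a 2-scattered linear set\<close>

locale two_scattered_plane = vector_space smul
  for smul :: "'k::{field,finite} \<Rightarrow> 'v::ab_group_add \<Rightarrow> 'v" +
  fixes \<phi> :: "'f::{field,finite} \<Rightarrow> 'k" and U :: "'v set"
  assumes embedding: "field_embedding \<phi>"
    and finite_V: "finite (UNIV :: 'v set)"
    and dim_V: "dim UNIV = 3"
    and scattered: "two_scattered \<phi> smul U"
begin

lemma finite_vectors [simp]: "finite (A :: 'v set)"
  by (rule finite_subset[OF subset_UNIV finite_V])

lemma one_less_card_scalars: "1 < CARD('f)"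
proof -
  have "card {0, 1 :: 'f} \<le> CARD('f)" by (rule card_mono) auto
  thus ?thesis by simp
qed

sublocale F: vector_space "restrict_scalars \<phi> smul"
  using embedding
  by unfold_locales
    (simp_all add: restrict_scalars_def field_embedding_def scale_left_distrib scale_right_distrib)

lemma subspace_restrict: "subspace W \<Longrightarrow> F.subspace W"
  by (unfold subspace_def F.subspace_def) (simp add: restrict_scalars_def)

lemma subspace_U: "F.subspace U"
  using scattered by (simp add: two_scattered_def)

lemma span_restrict_subset: "F.span S \<subseteq> span S"
  by (rule F.span_minimal[OF span_superset subspace_restrict[OF subspace_span]])

text \<open>
  The points of the linear set span the plane, so a proper \<open>\<bbbF>\<^bsub>q^n\<^esub>\<close>-subspace always
  misses a vector of \<open>U\<close>.
\<close>

lemma subspace_containing_U: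
  assumes "subspace W" and "U \<subseteq> W"
  shows "W = UNIV"
proof -
  have "span {u} \<subseteq> W" if "u \<in> U" for u
    using that assms by (intro span_minimal) auto
  hence "\<Union> (linear_set smul U) \<subseteq> W"
    by (auto simp: linear_set_def)
  hence "span (\<Union> (linear_set smul U)) \<subseteq> W"
    using assms(1) by (rule span_minimal)
  thus ?thesis using scattered by (auto simp: two_scattered_def)
qed

lemma span_pair_line:
  assumes "u \<noteq> 0" and "w \<notin> span {u}"
  shows "projective_line smul (span {w, u})"
proof -
  have ind: "independent {w, u}" using assms by (simp add: independent_insert)
  have "w \<noteq> u" using assms(2) span_base by blast
  thus ?thesis using dim_span_eq_card_independent[OF ind] by (simp add: projective_line_def)
qed

lemma card_line_Int_le:
  assumes "projective_line smul W"
  shows "card (U \<inter> W) \<le> CARD('f) ^ 2"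
proof -
  have W: "subspace W" using assms by (simp add: projective_line_def)
  have "F.dim (W \<inter> U) \<le> 2" using scattered assms by (simp add: two_scattered_def)
  moreover have "card (W \<inter> U) = CARD('f) ^ F.dim (W \<inter> U)"
    by (intro card_subspace F.vector_space_axioms F.subspace_inter subspace_restrict W subspace_U)
      simp
  ultimately show ?thesis
    using one_less_card_scalars by (simp add: power_increasing Int_commute)
qed

lemma ex_outside_point:
  obtains w where "w \<in> U" and "w \<notin> span {u}"
proof -
  have "dim (span {u}) \<le> 1" using dim_le_card[of "span {u}" "{u}"] by simp
  hence "dim (span {u}) \<noteq> dim UNIV" using dim_V by linarith
  hence "span {u} \<noteq> UNIV" by metis
  thus ?thesis using subspace_containing_U[of "span {u}"] that by auto
qed

text \<open>
  Otherwise some \<open>v \<in> U\<close> in the point of \<open>u\<close> is \<open>\<bbbF>\<^sub>q\<close>-independent of \<open>u\<close>. With any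
  \<open>w \<in> U\<close> outside the point, the line joining \<open>u\<close> and \<open>w\<close> contains the \<open>q^3\<close> vectors of the
  \<open>\<bbbF>\<^sub>q\<close>-span of \<open>u\<close>, \<open>v\<close>, \<open>w\<close>, too many for a line of a 2-scattered set.
\<close>

lemma point_Int_U:
  assumes u: "u \<in> U" "u \<noteq> 0"
  shows "U \<inter> span {u} = F.span {u}"
proof
  show "F.span {u} \<subseteq> U \<inter> span {u}"
    using span_restrict_subset[of "{u}"] F.span_minimal[OF _ subspace_U, of "{u}"] u by auto
  show "U \<inter> span {u} \<subseteq> F.span {u}"
  proof (rule ccontr)
    assume "\<not> U \<inter> span {u} \<subseteq> F.span {u}"
    then obtain v where v: "v \<in> U" "v \<in> span {u}" "v \<notin> F.span {u}" by auto
    obtain w where w: "w \<in> U" "w \<notin> span {u}" using ex_outside_point by blast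
    have "span {v, u} \<subseteq> span {u}"
      using v(2) by (intro span_minimal) (auto simp: span_base)
    hence w': "w \<notin> F.span {v, u}" using w(2) span_restrict_subset by blast
    have ind: "F.independent {w, v, u}"
      using u(2) v(3) w' by (simp add: F.independent_insert)
    have "v \<noteq> u" using v(3) F.span_base by blast
    moreover have "w \<noteq> u" "w \<noteq> v" using v(2) w(2) span_base by blast+
    ultimately have "CARD('f) ^ 3 = card (F.span {w, v, u})"
      using card_span_independent[OF F.vector_space_axioms _ ind]
      by (simp add: power3_eq_cube)
    also have "\<dots> \<le> card (U \<inter> span {w, u})"
    proof (rule card_mono)
      have "v \<in> span {w, u}" using v(2) span_mono[of "{u}" "{w, u}"] by auto
      thus "F.span {w, v, u} \<subseteq> U \<inter> span {w, u}"
        using u v w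
        by (intro F.span_minimal F.subspace_inter subspace_U subspace_restrict subspace_span)
          (auto simp: span_base)
    qed simp
    also have "\<dots> \<le> CARD('f) ^ 2"
      using u(2) w(2) by (intro card_line_Int_le span_pair_line)
    finally show False
      using one_less_card_scalars power_strict_increasing[of 2 3 "CARD('f)"] by simp
  qed
qed

lemma span_eq_point_iff:
  assumes "x \<noteq> 0"
  shows "span {x} = span {u} \<longleftrightarrow> x \<in> span {u}"
proof
  assume "x \<in> span {u}"
  then obtain c where c: "x = smul c u" by (auto simp: span_singleton)
  with assms have "c \<noteq> 0" by auto
  hence "u = smul (inverse c) x" using c by simp
  hence "u \<in> span {x}" by (auto simp: span_singleton)
  thus "span {x} = span {u}" using \<open>x \<in> span {u}\<close> by (simp add: span_eq)
next
  assume "span {x} = span {u}"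
  thus "x \<in> span {u}" using span_base by blast
qed

text \<open>
  The map sending a nonzero vector of \<open>U \<inter> W\<close> to its point has all fibres of size \<open>q - 1\<close>, because
  a fibre is a one-dimensional \<open>\<bbbF>\<^sub>q\<close>-subspace without zero.
\<close>

lemma card_points_in_subspace:
  assumes W: "subspace W"
  shows "(CARD('f) - 1) * card (linear_set smul (U \<inter> W)) = card (U \<inter> W) - 1"
proof -
  let ?S = "U \<inter> W - {0}"
  have fibre: "card {x \<in> ?S. span {x} = P} = CARD('f) - 1" if "P \<in> linear_set smul (U \<inter> W)" for P
  proof -
    obtain u where u: "u \<in> U" "u \<in> W" "u \<noteq> 0" and P: "P = span {u}"
      using \<open>P \<in> _\<close> by (auto simp: linear_set_def)
    have "span {u} \<subseteq> W" using u W by (intro span_minimal) auto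
    hence "{x \<in> ?S. span {x} = P} = U \<inter> span {u} - {0}"
      unfolding P by (auto simp: span_eq_point_iff cong: conj_cong)
    also have "\<dots> = F.span {u} - {0}" using point_Int_U u by simp
    also have "card \<dots> = CARD('f) - 1"
      using card_span_independent[OF F.vector_space_axioms, of "{u}"] u(3)
      by (simp add: card_Diff_singleton F.span_zero)
    finally show ?thesis .
  qed
  have "card ?S = (\<Sum>P \<in> linear_set smul (U \<inter> W). card {x \<in> ?S. span {x} = P})"
    unfolding linear_set_def card_eq_sum by (rule sum.image_gen) simp
  also have "\<dots> = card (linear_set smul (U \<inter> W)) * (CARD('f) - 1)"
    using fibre by simp
  finally have "card ?S = card (linear_set smul (U \<inter> W)) * (CARD('f) - 1)" .
  moreover have "0 \<in> U \<inter> W"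
    using W subspace_U by (simp add: subspace_0 F.subspace_0)
  ultimately show ?thesis by (simp add: card_Diff_singleton mult.commute)
qed

lemma card_points_if_card_vectors:
  assumes "subspace W" and "card (U \<inter> W) = CARD('f) ^ 2"
  shows "card (linear_set smul (U \<inter> W)) = CARD('f) + 1"
proof -
  have "(CARD('f) - 1) * card (linear_set smul (U \<inter> W)) = (CARD('f) - 1) * (CARD('f) + 1)"
    using card_points_in_subspace[OF assms(1)] assms(2)
    by (simp add: power2_eq_square algebra_simps)
  thus ?thesis
    using one_less_card_scalars nat_mult_eq_cancel1[of "CARD('f) - 1"] by (metis zero_less_diff)
qed

lemma card_points_on_line_le:
  assumes "projective_line smul W"
  shows "card (linear_set smul (U \<inter> W)) \<le> CARD('f) + 1"
proof -
  have W: "subspace W" using assms by (simp add: projective_line_def)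
  have "(CARD('f) - 1) * card (linear_set smul (U \<inter> W)) \<le> CARD('f) ^ 2 - 1"
    using card_points_in_subspace[OF W] card_line_Int_le[OF assms] by simp
  also have "\<dots> = (CARD('f) - 1) * (CARD('f) + 1)"
    by (simp add: power2_eq_square algebra_simps)
  finally show ?thesis
    using one_less_card_scalars nat_mult_le_cancel1[of "CARD('f) - 1"] by (metis zero_less_diff)
qed

text \<open>
  A complement of the kernel is spanned by any vector \<open>v0\<close> outside it, so adding \<open>v0\<close> raises the
  dimension of the kernel by one, to three.
\<close>

lemma kernel_line:
  assumes "Vector_Spaces.linear smul (*) f" and "f v0 \<noteq> 0"
  shows "projective_line smul {v. f v = 0}"
proof -
  interpret f: Vector_Spaces.linear smul "(*)" f by fact
  interpret fin: finite_dimensional_vector_space smul "extend_basis {}"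
    by unfold_locales
      (simp_all add: independent_extend_basis independent_empty span_extend_basis)
  let ?W = "{v. f v = 0}"
  have W: "subspace ?W"
    by (auto simp: subspace_def f.add f.scale f.zero)
  have "v \<in> span (insert v0 ?W)" for v
  proof -
    have "v - smul (f v / f v0) v0 \<in> ?W"
      using assms(2) by (simp add: f.diff f.scale)
    hence "v - smul (f v / f v0) v0 \<in> span ?W" by (rule span_base)
    thus ?thesis by (auto simp: span_insert)
  qed
  hence "span (insert v0 ?W) = UNIV" by auto
  hence "dim (insert v0 ?W) = 3" using dim_V dim_span by metis
  moreover have "v0 \<notin> span ?W" using W assms(2) by (simp add: span_eq_iff[THEN iffD2])
  ultimately have "dim ?W = 2" by (simp add: fin.dim_insert)
  thus ?thesis using W by (simp add: projective_line_def)
qed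

text \<open>
  Whether a functional vanishes at a vector depends only on the point spanned by it. The
  representatives \<open>g j\<close> need not lie in \<open>U\<close>; this is what allows them to be replaced by
  vectors of \<open>U\<close> in the count.
\<close>

lemma card_zero_representatives:
  assumes g: "bij_betw (\<lambda>j. span {g j}) UNIV (linear_set smul U)"
    and f: "Vector_Spaces.linear smul (*) f" and v0: "f v0 \<noteq> 0"
  shows "card {j. f (g j) = 0} = card (linear_set smul (U \<inter> {v. f v = 0}))"
proof -
  let ?W = "{v. f v = 0}"
  have W: "subspace ?W" using kernel_line[OF f v0] by (simp add: projective_line_def)
  have "x \<in> ?W \<longleftrightarrow> span {x} \<subseteq> ?W" for x
    using span_minimal[OF _ W, of "{x}"] span_base[of x "{x}"] by blast
  hence same: "x \<in> ?W \<longleftrightarrow> y \<in> ?W" if "span {x} = span {y}" for x y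
    using that by metis
  have surj: "range (\<lambda>j. span {g j}) = linear_set smul U"
    using g by (simp add: bij_betw_def)
  have "(\<lambda>j. span {g j}) ` {j. f (g j) = 0} = linear_set smul (U \<inter> ?W)"
  proof (intro equalityI subsetI)
    fix P assume "P \<in> (\<lambda>j. span {g j}) ` {j. f (g j) = 0}"
    then obtain j where j: "g j \<in> ?W" "P = span {g j}" by auto
    moreover have "P \<in> linear_set smul U" using j surj by blast
    then obtain u where "u \<in> U - {0}" "P = span {u}" by (auto simp: linear_set_def)
    ultimately show "P \<in> linear_set smul (U \<inter> ?W)"
      using same[of "g j" u] by (auto simp: linear_set_def)
  next
    fix P assume "P \<in> linear_set smul (U \<inter> ?W)"
    then obtain u where u: "u \<in> U - {0}" "u \<in> ?W" "P = span {u}"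
      by (auto simp: linear_set_def)
    hence "P \<in> range (\<lambda>j. span {g j})" unfolding surj linear_set_def by blast
    then obtain j where j: "P = span {g j}" by blast
    hence "g j \<in> ?W" using u same[of "g j" u] by simp
    thus "P \<in> (\<lambda>j. span {g j}) ` {j. f (g j) = 0}" using j by blast
  qed
  moreover have "inj_on (\<lambda>j. span {g j}) {j. f (g j) = 0}"
    using g by (meson bij_betw_def inj_on_subset subset_UNIV)
  ultimately show ?thesis by (metis card_image)
qed

end

section \<open>The code\<close>

text \<open>
  Pigeonhole: the two linear forms together map the vectors over a field of order \<open>Q\<close>, of which
  there are \<open>Q^3\<close>, to only \<open>Q^2\<close> pairs, and the difference of two vectors with the same image is orthogonal to both \<open>x\<close> and \<open>y\<close>.
\<close>

lemma ex_orthogonal_to_two: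
  fixes x y :: "'k::{field,finite} ^ 3"
  obtains a where "a \<noteq> 0" and "(\<Sum>i\<in>UNIV. a $ i * x $ i) = 0" and "(\<Sum>i\<in>UNIV. a $ i * y $ i) = 0"
proof -
  let ?h = "\<lambda>a :: 'k ^ 3. (\<Sum>i\<in>UNIV. a $ i * x $ i, \<Sum>i\<in>UNIV. a $ i * y $ i)"
  have "card {0, 1 :: 'k} \<le> CARD('k)" by (rule card_mono) auto
  hence "1 < CARD('k)" by simp
  hence "CARD('k \<times> 'k) < CARD('k ^ 3)"
    using power_strict_increasing[of 2 3 "CARD('k)"]
    by (simp add: power2_eq_square)
  hence "\<not> inj ?h"
    using card_inj_on_le[of ?h UNIV UNIV] by auto
  then obtain b c where bc: "b \<noteq> c" "?h b = ?h c" by (auto simp: inj_def)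
  show ?thesis
    using bc by (intro that[of "b - c"]) (auto simp: algebra_simps sum_subtractf)
qed

theorem mainTheorem6:
  fixes q n N :: nat
    and \<phi> :: "'f::{field,finite} \<Rightarrow> 'k::{field,finite}"
    and smul :: "'k \<Rightarrow> 'v::ab_group_add \<Rightarrow> 'v"
    and U :: "'v set"
    and coord :: "'v \<Rightarrow> 'k ^ 3"
    and g :: "'m::finite \<Rightarrow> 'v"
    and C :: "('k ^ 'm) set"
  assumes "primepow q" and "n \<ge> 3"
    and "CARD('f) = q" and "CARD('k) = q ^ n" and "field_embedding \<phi>"
    and "vector_space smul" and "vector_space.dim smul UNIV = 3"
    and "Vector_Spaces.linear smul (*s) coord" and "bij coord"
    and "maximum_two_scattered n \<phi> smul U"
    and "N = card (linear_set smul U)"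
    and "bij_betw (\<lambda>j. module.span smul {g j}) UNIV (linear_set smul U)"
    and "C = code_of_matrix (generator_matrix coord g)"
  shows "real N = (real q ^ n - 1) / (real q - 1)
    \<and> CARD('m) = N
    \<and> vec.subspace C
    \<and> vec.dim C = 3
    \<and> int (min_distance C) = int N - int q - 1
    \<and> singleton_defect C = int q - 1
    \<and> (q = 2 \<longrightarrow> almost_MDS C)"
proof -
  have card_f: "CARD('f) = q" by fact
  have "finite (UNIV :: 'v set)"
    using \<open>bij coord\<close> by (simp add: bij_betw_finite[of coord UNIV UNIV])
  hence "two_scattered_plane smul \<phi> U"
    using assms
    by (simp add: two_scattered_plane_def two_scattered_plane_axioms_def
        maximum_two_scattered_def)
  then interpret P: two_scattered_plane smul \<phi> U .
  interpret coord: Vector_Spaces.linear smul "(*s)" coord by fact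
  have q: "1 < q" using P.one_less_card_scalars card_f by simp

  have "card U = q ^ n"
    using card_subspace[OF P.F.vector_space_axioms P.subspace_U] assms(3,10)
    by (simp add: maximum_two_scattered_def)
  hence N: "(q - 1) * N = q ^ n - 1"
    using P.card_points_in_subspace[OF P.subspace_UNIV] assms(3,11) by simp
  have "real ((q - 1) * N) = real (q ^ n - 1)" using N by simp
  hence N_real: "real N = (real q ^ n - 1) / (real q - 1)"
    using q by (simp add: of_nat_diff field_simps)
  have card_m: "CARD('m) = N"
    using bij_betw_same_card[OF assms(12)] assms(11) by simp
  have "q ^ 2 - 1 < q ^ n - 1"
    using q power_strict_increasing[of 2 n q] assms(2)
    by (intro diff_less_mono) simp_all
  moreover have "q ^ 2 - 1 = (q - 1) * (q + 1)"
    by (simp add: power2_eq_square algebra_simps)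
  ultimately have "(q - 1) * (q + 1) < (q - 1) * N" using N by simp
  hence N_gt: "q + 1 < N" by (rule mult_less_cancel1[THEN iffD1, THEN conjunct2])

  \<comment> \<open>The rows of the generator matrix are the coordinate functionals evaluated at the
    representatives, so \<open>c a\<close> is the combination of the rows with coefficients \<open>a\<close>.\<close>
  define f where "f a v = (\<Sum>i\<in>UNIV. a $ i * coord v $ i)" for a :: "'k ^ 3" and v
  define c where "c a = (\<chi> j. f a (g j))" for a
  have f_linear: "Vector_Spaces.linear smul (*) (f a)" for a
    by unfold_locales
      (simp_all add: f_def coord.add coord.scale sum.distrib algebra_simps sum_distrib_left)
  have f_nonzero: "\<exists>v. f a v \<noteq> 0" if "a \<noteq> 0" for a
  proof -
    obtain i where i: "a $ i \<noteq> 0" using \<open>a \<noteq> 0\<close> by (auto simp: vec_eq_iff)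
    obtain v where "coord v = axis i 1" using \<open>bij coord\<close> by (metis bij_pointE)
    hence "f a v = a $ i" by (simp add: f_def axis_def if_distrib cong: if_cong)
    thus ?thesis using i by metis
  qed
  have line: "projective_line smul {v. f a v = 0}" if "a \<noteq> 0" for a
    using P.kernel_line[OF f_linear] f_nonzero[OF that] by blast

  have zeros: "card {j. c a $ j = 0} = card (linear_set smul (U \<inter> {v. f a v = 0}))"
    if "a \<noteq> 0" for a
    using P.card_zero_representatives[OF assms(12) f_linear] f_nonzero[OF that]
    by (auto simp: c_def)
  have zeros_le: "card {j. c a $ j = 0} \<le> q + 1" if "a \<noteq> 0" for a
    using zeros[OF that] P.card_points_on_line_le[OF line[OF that]] card_f by simp

  have c_linear: "Vector_Spaces.linear (*s) (*s) c"
    by unfold_locales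
      (simp_all add: c_def f_def vec_eq_iff sum.distrib algebra_simps sum_distrib_left)
  interpret c: Vector_Spaces.linear "(*s)" "(*s)" c by (rule c_linear)
  have c_inj: "inj c"
  proof (subst c.inj_iff_eq_0, intro allI impI)
    fix a assume "c a = 0"
    thus "a = 0" using zeros_le[of a] N_gt card_m by auto
  qed
  have "range c = C"
  proof -
    let ?G = "generator_matrix coord g"
    have c_axis: "c (axis i 1) = row i ?G" for i
      by (simp add: c_def f_def row_def generator_matrix_def vec_eq_iff axis_def if_distrib
          if_distribR cong: if_cong)
    have "rows ?G = c ` cart_basis"
      by (auto simp: rows_def cart_basis_def c_axis[symmetric])
    thus ?thesis
      using vec.linear_span_image[OF c_linear, of cart_basis] assms(13)
      by (simp add: code_of_matrix_def vec.span_Basis)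
  qed
  have C_subspace: "vec.subspace C" using assms(13) by (simp add: code_of_matrix_def)
  have C_dim: "vec.dim C = 3"
    using vec.dim_image_eq[OF c_linear, of UNIV] c_inj \<open>range c = C\<close> by (simp add: vec.dim_UNIV card_cart_basis)

  have dist: "hamming_dist (c a) (c b) = N - card {j. c (a - b) $ j = 0}" for a b
  proof -
    have "{j. c a $ j \<noteq> c b $ j} = UNIV - {j. c (a - b) $ j = 0}" by (auto simp: c.diff)
    thus ?thesis by (simp add: hamming_dist_def card_Diff_subset card_m)
  qed
  \<comment> \<open>The line joining two points of the linear set carries exactly \<open>q + 1\<close> of them: it contains
    the \<open>q^2\<close> vectors of the span of \<open>u\<close> and \<open>w\<close> over the small field.\<close>
  have "\<exists>a. a \<noteq> 0 \<and> card {j. c a $ j = 0} = q + 1"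
  proof -
    obtain u where u: "u \<in> U" "u \<noteq> 0" using P.ex_outside_point[of 0] by auto
    obtain w where w: "w \<in> U" "w \<notin> P.span {u}" using P.ex_outside_point by blast
    obtain a where a: "a \<noteq> 0" "f a u = 0" "f a w = 0"
      unfolding f_def using ex_orthogonal_to_two[of "coord u" "coord w"] by blast
    let ?W = "{v. f a v = 0}"
    have W: "P.subspace ?W" using line[OF a(1)] by (simp add: projective_line_def)
    have "w \<notin> P.F.span {u}" using w(2) P.span_restrict_subset by blast
    hence "P.F.independent {w, u}" "w \<noteq> u"
      using u(2) P.F.span_base by (auto simp: P.F.independent_insert)
    hence "q ^ 2 = card (P.F.span {w, u})"
      using card_span_independent[OF P.F.vector_space_axioms, of "{w, u}"] card_f
      by (simp add: power2_eq_square)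
    also have "\<dots> \<le> card (U \<inter> ?W)"
    proof (rule card_mono)
      show "P.F.span {w, u} \<subseteq> U \<inter> ?W"
        using u w a by (intro P.F.span_minimal P.F.subspace_inter P.subspace_U P.subspace_restrict W) auto
    qed simp
    finally have "card (U \<inter> ?W) = q ^ 2" using P.card_line_Int_le[OF line[OF a(1)]] card_f by simp
    thus ?thesis using zeros[OF a(1)] P.card_points_if_card_vectors[OF W] a(1) card_f by auto
  qed
  then obtain a0 where a0: "a0 \<noteq> 0" "card {j. c a0 $ j = 0} = q + 1" by blast
  have min: "min_distance C = N - (q + 1)"
    unfolding min_distance_def
  proof (rule Min_eqI)
    show "finite {hamming_dist x y |x y. x \<in> C \<and> y \<in> C \<and> x \<noteq> y}"
      by (rule finite_subset[of _ "range (\<lambda>(x, y). hamming_dist x y)"]) auto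
  next
    fix d assume "d \<in> {hamming_dist x y |x y. x \<in> C \<and> y \<in> C \<and> x \<noteq> y}"
    then obtain a b where "a \<noteq> b" "d = hamming_dist (c a) (c b)"
      using \<open>range c = C\<close> by (smt (verit) mem_Collect_eq rangeE)
    thus "N - (q + 1) \<le> d" using zeros_le[of "a - b"] by (simp add: dist)
  next
    have "c a0 \<noteq> c 0" using a0(1) c_inj by (metis injD)
    moreover have "hamming_dist (c a0) (c 0) = N - (q + 1)" using dist[of a0 0] a0(2) by simp
    ultimately show "N - (q + 1) \<in> {hamming_dist x y |x y. x \<in> C \<and> y \<in> C \<and> x \<noteq> y}"
      using \<open>range c = C\<close> by (metis (mono_tags, lifting) mem_Collect_eq rangeI)
  qed
  have d: "int (min_distance C) = int N - int q - 1" using min N_gt by simp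
  show ?thesis
    using N_real card_m C_subspace C_dim d
    by (simp add: singleton_defect_def almost_MDS_def)
qed

end
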